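(* Let $a,b$ be integers with $0<a<b$ and $\gcd(a,b)=1$. Write $\frac{a}{b}=[0,a_1,\ldots,a_n]$ as a regular continued fraction with all partial quotients $a_1,\ldots,a_n$ positive integers and with $n$ odd. Let $a^*$ be the integer with $0<a^*<b$ and $aa^*\equiv 1 \pmod b$, and let $k$ be the positive integer with $aa^*=1+kb$. Define $T(a,b)=\sum_{j=1}^n(-1)^{j-1}a_j$ and $D(a,b)=\sum_{j=1}^n a_j$. Then: (1) If $a\equiv 1 \pmod 4$ or $a^*\equiv 1\pmod 4$, then $T(a,b)\equiv b-k \pmod 4$. (2) If $a\equiv 3 \pmod 4$ or $a^*\equiv 3\pmod 4$, then $T(a,b)\equiv 2+k-b \pmod 4$. (3) If $a\equiv 2 \pmod 4$ or $a^*\equiv 2\pmod 4$, then $b-k$ is even and $D(a,b)\equiv (b-k)/2 \pmod 2$.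
   Context: The requirement that $n$ be odd (rather than $a_n\ge 2$) makes the expansion unique: if the usual expansion has even length with last quotient $a_n\ge2$, one uses $[0,a_1,\ldots,a_n-1,1]$; if it has even length with $a_n=1$, one uses $[0,a_1,\ldots,a_{n-1}+1]$. *)

theory Defs
  imports Complex_Main "HOL-Number_Theory.Cong"
begin

text \<open>The value of the finite continued fraction \<open>[c\<^sub>0, c\<^sub>1, \<dots>, c\<^sub>n]\<close>; the empty list is a
  dummy case.\<close>

fun cfrac_value :: "int list \<Rightarrow> rat" where
  "cfrac_value [] = 0"
| "cfrac_value [c] = of_int c"
| "cfrac_value (c # d # cs) = of_int c + 1 / cfrac_value (d # cs)"

text \<open>\<open>q j\<close> is the partial quotient \<open>a\<^sub>j\<close> for \<open>1 \<le> j \<le> n\<close>; other values of \<open>q\<close> are irrelevant.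
  The parity condition on \<open>n\<close> makes the expansion of a rational in \<open>(0, 1)\<close> unique, so the two
  sums below depend only on \<open>a\<close> and \<open>b\<close>.\<close>

definition odd_cfrac_expansion :: "int \<Rightarrow> int \<Rightarrow> nat \<Rightarrow> (nat \<Rightarrow> int) \<Rightarrow> bool" where
  "odd_cfrac_expansion a b n q \<longleftrightarrow>
     odd n \<and> (\<forall>j\<in>{1..n}. q j > 0) \<and>
     of_int a / of_int b = cfrac_value (0 # map q [1..<n + 1])"

definition cfrac_alt_sum :: "nat \<Rightarrow> (nat \<Rightarrow> int) \<Rightarrow> int" where
  "cfrac_alt_sum n q = (\<Sum>j = 1..n. (- 1) ^ (j - 1) * q j)"

definition cfrac_sum :: "nat \<Rightarrow> (nat \<Rightarrow> int) \<Rightarrow> int" where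
  "cfrac_sum n q = (\<Sum>j = 1..n. q j)"

end

theory Submission
  imports Defs
begin

text \<open>
  Let \<open>p\<^sub>j / q\<^sub>j\<close> be the convergents of \<open>[0, a\<^sub>1, \<dots>, a\<^sub>n]\<close>. As \<open>n\<close> is odd,
  \<open>p\<^sub>n q\<^sub>n\<^sub>-\<^sub>1 - p\<^sub>n\<^sub>-\<^sub>1 q\<^sub>n = 1\<close>, which forces \<open>a* = q\<^sub>n\<^sub>-\<^sub>1\<close> and \<open>k = p\<^sub>n\<^sub>-\<^sub>1\<close>. Now
  \<open>SL\<^sub>2(\<int>)\<close> has a character with values in \<open>\<int>/4\<int>\<close> that sends the two elementary unipotent
  matrices to \<open>1\<close> and \<open>-1\<close>, and it factors through \<open>SL\<^sub>2(\<int>/4\<int>)\<close>. Writing the matrix of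
  convergents as a product of unipotent matrices shows that its value on the matrix with rows
  \<open>(a*, b)\<close> and \<open>(k, a)\<close> is \<open>T(a, b)\<close>. So \<open>T(a, b)\<close> mod 4 depends only on \<open>a, a*, b, k\<close> mod 4,
  and the three claims are read off from finitely many cases.
\<close>

section \<open>Matrices of convergents\<close>

text \<open>The entries are \<open>(p\<^sub>n\<^sub>-\<^sub>1, p\<^sub>n, q\<^sub>n\<^sub>-\<^sub>1, q\<^sub>n)\<close> for the convergents of \<open>[0, a\<^sub>1, \<dots>, a\<^sub>n]\<close>,
  read off from the product of the matrices with rows \<open>(0, 1)\<close> and \<open>(1, a\<^sub>j)\<close>.\<close>

fun convergent_matrix :: "int list \<Rightarrow> int \<times> int \<times> int \<times> int" where
  "convergent_matrix [] = (1, 0, 0, 1)"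
| "convergent_matrix (x # xs) =
     (case convergent_matrix xs of (p', p, q', q) \<Rightarrow> (q', q, p' + x * q', p + x * q))"

lemma convergent_matrix_det:
  "convergent_matrix xs = (p', p, q', q) \<Longrightarrow> p' * q - p * q' = (- 1) ^ length xs"
proof (induction xs arbitrary: p' p q' q)
  case (Cons x xs)
  obtain r' r s' s where m: "convergent_matrix xs = (r', r, s', s)"
    by (metis prod_cases4)
  show ?case
    using Cons.IH[OF m] Cons.prems m by (auto simp: algebra_simps)
qed auto

text \<open>These bounds put \<open>q'\<close> in the range where an inverse modulo \<open>q\<close>
  is pinned down. The empty list is excluded because it gives \<open>q' = 0\<close>.\<close>

lemma convergent_matrix_bounds:
  assumes "convergent_matrix xs = (p', p, q', q)" "\<forall>x\<in>set xs. x > 0" "xs \<noteq> []"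
  shows "0 \<le> p' \<and> p' \<le> p \<and> 0 < q' \<and> q' \<le> q"
  using assms
proof (induction xs arbitrary: p' p q' q)
  case (Cons x xs)
  obtain r' r s' s where m: "convergent_matrix xs = (r', r, s', s)"
    by (metis prod_cases4)
  show ?case
  proof (cases "xs = []")
    case True
    then show ?thesis using Cons.prems by auto
  next
    case False
    then have IH: "0 \<le> r' \<and> r' \<le> r \<and> 0 < s' \<and> s' \<le> s"
      using Cons.IH[OF m] Cons.prems by auto
    have "x > 0" using Cons.prems by simp
    then have "x * s' > 0" "x * s' \<le> x * s" using IH by auto
    then have "0 < r' + x * s'" "r' + x * s' \<le> r + x * s" using IH by linarith+
    then show ?thesis using Cons.prems m IH by auto
  qed
qed auto

lemma cfrac_value_Cons: "cfrac_value (x # xs) = of_int x + cfrac_value (0 # xs)"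
  by (cases xs) auto

lemma cfrac_value_convergent_matrix:
  assumes "convergent_matrix xs = (p', p, q', q)" "\<forall>x\<in>set xs. x > 0"
  shows "cfrac_value (0 # xs) = of_int p / of_int q"
  using assms
proof (induction xs arbitrary: p' p q' q)
  case (Cons x xs)
  obtain r' r s' s where m: "convergent_matrix xs = (r', r, s', s)"
    by (metis prod_cases4)
  have "s > 0"
    using convergent_matrix_bounds[OF m] Cons.prems m by (cases "xs = []") auto
  moreover have "cfrac_value (0 # xs) = of_int r / of_int s"
    using Cons.IH[OF m] Cons.prems by auto
  then have "cfrac_value (0 # x # xs) = 1 / (of_int x + of_int r / of_int s)"
    using cfrac_value_Cons[of x xs] by simp
  ultimately show ?case
    using Cons.prems m by (auto simp: field_simps)
qed auto

section \<open>The character modulo 4\<close>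

text \<open>Modulo 4 and for determinant 1 this is Kubert and Lang's polynomial expression for a
  generator of the character group of \<open>SL\<^sub>2(\<int>)\<close>, evaluated at the matrix with rows
  \<open>(a, b)\<close> and \<open>(c, d)\<close>.\<close>

definition sl2_character :: "int \<Rightarrow> int \<Rightarrow> int \<Rightarrow> int \<Rightarrow> int" where
  "sl2_character a b c d =
     (1 - c * c) * (b * d + 3 * (c - 1) * d + c + 3) + c * (a + d - 3)"

lemma sl2_character_cong:
  assumes "[a = a'] (mod m)" "[b = b'] (mod m)" "[c = c'] (mod m)" "[d = d'] (mod m)"
  shows "[sl2_character a b c d = sl2_character a' b' c' d'] (mod m)"
  unfolding sl2_character_def
  by (intro cong_add cong_mult cong_diff cong_refl assms)

lemma residue_mod_4: "(x::int) mod 4 \<in> {0, 1, 2, 3}"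
  by auto

text \<open>Adding \<open>x\<close> times the lower row to the upper one is left multiplication by a
  unipotent matrix of character \<open>x\<close>. Modulo 4 only finitely many cases remain.\<close>

lemma sl2_character_upper_residues:
  "\<forall>a\<in>{0,1,2,3}. \<forall>b\<in>{0,1,2,3}. \<forall>c\<in>{0,1,2,3}. \<forall>d\<in>{0,1,2,3}. (a * d - b * c) mod 4 = 1 \<longrightarrow>
     (\<forall>x\<in>{0,1,2,3}.
       sl2_character (a + x * c) (b + x * d) c d mod 4 = (sl2_character a b c d + x) mod 4)"
  by (simp add: sl2_character_def)

text \<open>The lower elementary matrix is conjugate to the inverse of the upper one, hence the
  opposite sign.\<close>

lemma sl2_character_lower_residues:
  "\<forall>a\<in>{0,1,2,3}. \<forall>b\<in>{0,1,2,3}. \<forall>c\<in>{0,1,2,3}. \<forall>d\<in>{0,1,2,3}. (a * d - b * c) mod 4 = 1 \<longrightarrow>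
     (\<forall>x\<in>{0,1,2,3}.
       sl2_character a b (c + x * a) (d + x * b) mod 4 = (sl2_character a b c d - x) mod 4)"
  by (simp add: sl2_character_def)

lemma sl2_character_upper:
  assumes "a * d - b * c = 1"
  shows "[sl2_character (a + x * c) (b + x * d) c d = sl2_character a b c d + x] (mod 4)"
proof -
  let ?a = "a mod 4" and ?b = "b mod 4" and ?c = "c mod 4" and ?d = "d mod 4" and ?x = "x mod 4"
  have r: "[a = ?a] (mod 4)" "[b = ?b] (mod 4)" "[c = ?c] (mod 4)" "[d = ?d] (mod 4)"
    "[x = ?x] (mod 4)"
    by (simp_all add: cong_def)
  have "[a * d - b * c = ?a * ?d - ?b * ?c] (mod 4)"
    by (intro cong_diff cong_mult r)
  then have det: "(?a * ?d - ?b * ?c) mod 4 = 1"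
    using assms by (simp add: cong_def)
  have "[sl2_character (a + x * c) (b + x * d) c d =
         sl2_character (?a + ?x * ?c) (?b + ?x * ?d) ?c ?d] (mod 4)"
    by (intro sl2_character_cong cong_add cong_mult r)
  also have "[sl2_character (?a + ?x * ?c) (?b + ?x * ?d) ?c ?d =
              sl2_character ?a ?b ?c ?d + ?x] (mod 4)"
    using sl2_character_upper_residues det residue_mod_4 unfolding cong_def by blast
  also have "[sl2_character ?a ?b ?c ?d + ?x = sl2_character a b c d + x] (mod 4)"
    by (intro sl2_character_cong cong_add r[THEN cong_sym])
  finally show ?thesis .
qed

lemma sl2_character_lower:
  assumes "a * d - b * c = 1"
  shows "[sl2_character a b (c + x * a) (d + x * b) = sl2_character a b c d - x] (mod 4)"
proof -
  let ?a = "a mod 4" and ?b = "b mod 4" and ?c = "c mod 4" and ?d = "d mod 4" and ?x = "x mod 4"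
  have r: "[a = ?a] (mod 4)" "[b = ?b] (mod 4)" "[c = ?c] (mod 4)" "[d = ?d] (mod 4)"
    "[x = ?x] (mod 4)"
    by (simp_all add: cong_def)
  have "[a * d - b * c = ?a * ?d - ?b * ?c] (mod 4)"
    by (intro cong_diff cong_mult r)
  then have det: "(?a * ?d - ?b * ?c) mod 4 = 1"
    using assms by (simp add: cong_def)
  have "[sl2_character a b (c + x * a) (d + x * b) =
         sl2_character ?a ?b (?c + ?x * ?a) (?d + ?x * ?b)] (mod 4)"
    by (intro sl2_character_cong cong_add cong_mult r)
  also have "[sl2_character ?a ?b (?c + ?x * ?a) (?d + ?x * ?b) =
              sl2_character ?a ?b ?c ?d - ?x] (mod 4)"
    using sl2_character_lower_residues det residue_mod_4 unfolding cong_def by blast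
  also have "[sl2_character ?a ?b ?c ?d - ?x = sl2_character a b c d - x] (mod 4)"
    by (intro sl2_character_cong cong_diff r[THEN cong_sym])
  finally show ?thesis .
qed

section \<open>Alternating sums of partial quotients\<close>

text \<open>The alternating sum \<open>x\<^sub>1 - x\<^sub>2 + x\<^sub>3 - \<dots>\<close> is \<open>foldr (-) xs 0\<close>. For odd length the
  determinant is \<open>-1\<close>, so the rows are swapped to land in \<open>SL\<^sub>2(\<int>)\<close>.\<close>

lemma alternating_sum_eq_sl2_character:
  assumes "convergent_matrix xs = (p', p, q', q)"
  shows "if even (length xs) then [foldr (-) xs 0 = - sl2_character p' p q' q] (mod 4)
         else [foldr (-) xs 0 = sl2_character q' q p' p] (mod 4)"
  using assms
proof (induction xs arbitrary: p' p q' q)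
  case Nil
  then show ?case by (auto simp: sl2_character_def)
next
  case (Cons x xs)
  obtain r' r s' s where m: "convergent_matrix xs = (r', r, s', s)"
    by (metis prod_cases4)
  have e: "p' = s'" "p = s" "q' = r' + x * s'" "q = r + x * s"
    using Cons.prems m by auto
  note det = convergent_matrix_det[OF m]
  show ?case
  proof (cases "even (length xs)")
    case True
    then have "[x - foldr (-) xs 0 = x - - sl2_character r' r s' s] (mod 4)"
      using Cons.IH[OF m] by (intro cong_diff) auto
    \<comment> \<open>The new list has odd length, so its rows are swapped, which makes it an upper
      shear of the old matrix.\<close>
    moreover have "[sl2_character (r' + x * s') (r + x * s) s' s
                    = sl2_character r' r s' s + x] (mod 4)"
      using det True by (intro sl2_character_upper) auto
    ultimately show ?thesis
      using True e by (auto simp: cong_def add.commute)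
  next
    case False
    then have "[x - foldr (-) xs 0 = x - sl2_character s' s r' r] (mod 4)"
      using Cons.IH[OF m] by (intro cong_diff) auto
    \<comment> \<open>Now the old matrix is the swapped one, and the new one is a lower shear of
      it.\<close>
    moreover have "[- sl2_character s' s (r' + x * s') (r + x * s)
                    = - (sl2_character s' s r' r - x)] (mod 4)"
      using det False
      by (subst cong_minus_minus_iff, intro sl2_character_lower) (auto simp: algebra_simps)
    ultimately show ?thesis
      using False e by (auto simp: cong_def)
  qed
qed

lemma cfrac_alt_sum_eq_foldr: "cfrac_alt_sum n q = foldr (-) (map q [1..<n + 1]) 0"
proof (induction n arbitrary: q)
  case 0
  show ?case by (simp add: cfrac_alt_sum_def)
next
  case (Suc n)
  have "cfrac_alt_sum (Suc n) q = q 1 + (\<Sum>j = Suc 1..Suc n. (- 1) ^ (j - 1) * q j)"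
    by (simp add: cfrac_alt_sum_def sum.atLeast_Suc_atMost)
  also have "(\<Sum>j = Suc 1..Suc n. (- 1) ^ (j - 1) * q j) = (\<Sum>j = 1..n. (- 1) ^ j * q (Suc j))"
    by (subst sum.shift_bounds_cl_Suc_ivl) simp
  also have "\<dots> = - cfrac_alt_sum n (\<lambda>j. q (Suc j))"
    unfolding cfrac_alt_sum_def sum_negf[symmetric]
  proof (rule sum.cong[OF refl])
    fix j assume "j \<in> {1..n}"
    then show "(- 1) ^ j * q (Suc j) = - ((- 1) ^ (j - 1) * q (Suc j))"
      by (cases j) auto
  qed
  finally have "cfrac_alt_sum (Suc n) q = q 1 - cfrac_alt_sum n (\<lambda>j. q (Suc j))"
    by simp
  moreover have "map q [1..<Suc n + 1] = q 1 # map (\<lambda>j. q (Suc j)) [1..<n + 1]"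
    by (simp add: upt_conv_Cons flip: map_Suc_upt del: upt_Suc)
  ultimately show ?case
    using Suc.IH[of "\<lambda>j. q (Suc j)"] by simp
qed

text \<open>Signs do not matter modulo 2, so claim (3) can be reduced to the character as
  well.\<close>

lemma even_cfrac_sum_iff: "even (cfrac_sum n q) \<longleftrightarrow> even (cfrac_alt_sum n q)"
proof -
  have "even (cfrac_alt_sum n q - cfrac_sum n q)"
    unfolding cfrac_alt_sum_def cfrac_sum_def sum_subtractf[symmetric]
    by (intro dvd_sum) (auto simp: minus_one_power_iff)
  then show ?thesis by simp
qed

section \<open>Reduced fractions and residue cases\<close>

lemma coprime_fraction_unique:
  fixes a b p q :: int
  assumes "of_int a / of_int b = (of_int p / of_int q :: rat)"
    and "coprime a b" "coprime p q" "b > 0" "q > 0"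
  shows "a = p" "b = q"
proof -
  have "(of_int (a * q) :: rat) = of_int (p * b)"
    using assms by (simp add: field_simps)
  then have eq: "a * q = p * b" by (simp only: of_int_eq_iff)
  then have "b dvd a * q" "q dvd p * b"
    using dvd_triv_right[of b p] dvd_triv_right[of q a] by auto
  then have "b dvd q" "q dvd b"
    using assms(2,3) by (auto simp: coprime_commute coprime_dvd_mult_right_iff)
  then show "b = q" using assms(4,5) by (simp add: zdvd_antisym_nonneg)
  then show "a = p" using eq assms(5) by simp
qed

text \<open>Writing \<open>z = 4 * w + 2 * (d mod 2)\<close> gives half of \<open>z\<close> as
  \<open>2 * w + d mod 2\<close>. This splits one residue modulo 4 into the two parts of claim
  (3).\<close>

lemma even_and_half_mod_2:
  fixes z d :: int
  assumes "z mod 4 = 2 * (d mod 2)"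
  shows "even z \<and> d mod 2 = z div 2 mod 2"
proof -
  have "z = 2 * (2 * (z div 4) + d mod 2)"
    using assms div_mult_mod_eq[of z 4] by simp
  then obtain w where "z = 2 * (2 * w + d mod 2)" ..
  then show ?thesis by simp
qed

lemma sl2_character_residues:
  "\<forall>a\<in>{0,1,2,3}. \<forall>b\<in>{0,1,2,3}. \<forall>a'\<in>{0,1,2,3}. \<forall>k\<in>{0,1,2,3::int}. (a' * a - b * k) mod 4 = 1 \<longrightarrow>
     (a = 1 \<or> a' = 1 \<longrightarrow> sl2_character a' b k a mod 4 = (b - k) mod 4) \<and>
     (a = 3 \<or> a' = 3 \<longrightarrow> sl2_character a' b k a mod 4 = (2 + k - b) mod 4) \<and>
     (a = 2 \<or> a' = 2 \<longrightarrow> (b - k) mod 4 = 2 * (sl2_character a' b k a mod 2))"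
  by (simp add: sl2_character_def)

theorem theorem1:
  fixes a b a' k T D :: int and n :: nat and q :: "nat \<Rightarrow> int"
  assumes "0 < a" and "a < b" and "gcd a b = 1"
    and "odd_cfrac_expansion a b n q"
    and "0 < a'" and "a' < b" and "[a * a' = 1] (mod b)"
    and "a * a' = 1 + k * b"
    and "T = cfrac_alt_sum n q"
    and "D = cfrac_sum n q"
  shows "([a = 1] (mod 4) \<or> [a' = 1] (mod 4) \<longrightarrow> [T = b - k] (mod 4)) \<and>
         ([a = 3] (mod 4) \<or> [a' = 3] (mod 4) \<longrightarrow> [T = 2 + k - b] (mod 4)) \<and>
         ([a = 2] (mod 4) \<or> [a' = 2] (mod 4) \<longrightarrow>
            even (b - k) \<and> [D = (b - k) div 2] (mod 2))"
proof -
  let ?xs = "map q [1..<n + 1]"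
  have n: "odd n" and pos: "\<forall>x\<in>set ?xs. x > 0"
    and val: "of_int a / of_int b = cfrac_value (0 # ?xs)"
    using assms(4) by (auto simp: odd_cfrac_expansion_def simp del: upt_Suc)
  obtain r' r s' s where m: "convergent_matrix ?xs = (r', r, s', s)"
    by (metis prod_cases4)
  have "?xs \<noteq> []" using n by (auto elim: oddE)
  then have bd: "0 \<le> r'" "r' \<le> r" "0 < s'" "s' \<le> s"
    using convergent_matrix_bounds[OF m pos] by auto
  have det: "r * s' - r' * s = 1"
    using convergent_matrix_det[OF m] n by (simp del: upt_Suc)
  have "coprime r s"
  proof (rule coprimeI)
    fix d assume "d dvd r" "d dvd s"
    then have "d dvd r * s' - r' * s" by simp
    then show "is_unit d" using det by simp
  qed
  then have ab: "a = r" "b = s"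
    using coprime_fraction_unique[of a b r s] val cfrac_value_convergent_matrix[OF m pos]
      assms(1-3) bd by (auto simp: coprime_iff_gcd_eq_1)
  have "a * (s' - a') = b * (r' - k)"
    using det assms(8) ab by (simp add: algebra_simps)
  then have "b dvd a * (s' - a')" by simp
  then have "b dvd s' - a'"
    using assms(3) by (simp add: coprime_dvd_mult_right_iff coprime_iff_gcd_eq_1 gcd.commute)
  \<comment> \<open>Both numbers lie in \<open>{1..b}\<close> and \<open>a' < b\<close>, so a
    difference divisible by \<open>b\<close> vanishes.\<close>
  moreover have "\<bar>s' - a'\<bar> < b"
    using assms(5,6) bd ab by auto
  ultimately have a': "a' = s'"
    using zdvd_not_zless[of "\<bar>s' - a'\<bar>" b] by auto
  \<comment> \<open>With \<open>a' = s'\<close>, comparing \<open>a * a' = 1 + k * b\<close> with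
    the determinant and cancelling \<open>b\<close> gives \<open>k\<close>.\<close>
  then have k: "k = r'"
    using det assms(1,2,8) ab by (auto simp: algebra_simps)

  let ?a = "a mod 4" and ?b = "b mod 4" and ?a' = "a' mod 4" and ?k = "k mod 4"
  let ?c = "sl2_character ?a' ?b ?k ?a"
  have res: "[a = ?a] (mod 4)" "[b = ?b] (mod 4)" "[a' = ?a'] (mod 4)" "[k = ?k] (mod 4)"
    by (simp_all add: cong_def)
  have "[T = sl2_character a' b k a] (mod 4)"
    using alternating_sum_eq_sl2_character[OF m] n assms(9)
    by (simp add: ab a' k cfrac_alt_sum_eq_foldr del: upt_Suc)
  also have "[sl2_character a' b k a = ?c] (mod 4)"
    by (intro sl2_character_cong res)
  finally have T: "T mod 4 = ?c mod 4" by (simp add: cong_def)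
  have "[a' * a - b * k = ?a' * ?a - ?b * ?k] (mod 4)"
    by (intro cong_diff cong_mult res)
  then have "(?a' * ?a - ?b * ?k) mod 4 = 1"
    using assms(8) by (simp add: cong_def algebra_simps)
  then have cases:
    "(?a = 1 \<or> ?a' = 1 \<longrightarrow> ?c mod 4 = (?b - ?k) mod 4) \<and>
     (?a = 3 \<or> ?a' = 3 \<longrightarrow> ?c mod 4 = (2 + ?k - ?b) mod 4) \<and>
     (?a = 2 \<or> ?a' = 2 \<longrightarrow> (?b - ?k) mod 4 = 2 * (?c mod 2))"
    using sl2_character_residues residue_mod_4 by blast
  have D: "even D \<longleftrightarrow> even T"
    using even_cfrac_sum_iff assms(9,10) by simp
  have "T mod 2 = ?c mod 2"
    using T by presburger
  then have D2: "D mod 2 = ?c mod 2"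
    using D by presburger
  have bk: "(?b - ?k) mod 4 = (b - k) mod 4" "(2 + ?k - ?b) mod 4 = (2 + k - b) mod 4"
    by presburger+
  note cases' = cases[unfolded bk T[symmetric] D2[symmetric]]
  have "even (b - k) \<and> D mod 2 = (b - k) div 2 mod 2" if "?a = 2 \<or> ?a' = 2"
    using cases' that by (intro even_and_half_mod_2) blast
  then show ?thesis
    using cases' by (simp add: cong_def)
qed

end
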